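(* Each ultrametric fractal is isometrically equivalent to a fractal in the Hilbert space $\ell_2$.
   Context: A self-map $f$ of a metric space $(M,d)$ is contracting if its Lipschitz constant $\mathrm{Lip}(f)=\sup_{x\neq y} d(f(x),f(y))/d(x,y)$ is $<1$. A metric fractal is a pair $(X,\mathcal F)$ consisting of a (non-empty) compact metric space $X$ and a finite family $\mathcal F$ of contracting self-maps of $X$ with $X=\bigcup_{f\in\mathcal F}f(X)$. A metric fractal $(X,\mathcal F)$ is an ultrametric fractal if the metric $d_X$ of $X$ is an ultrametric, i.e. $d_X(x,z)\le\max\{d_X(x,y),d_X(y,z)\}$ for all $x,y,z\in X$. A fractal in a complete metric space $M$ is a metric fractal $(L,\mathcal G)$ such that $L\subset M$ carries the metric inherited from $M$ and each $g\in\mathcal G$ is the restriction to $L$ of a contracting self-map of $M$ (equivalently, $L$ is the attractor of a finite system of contracting self-maps of $M$ and $\mathcal G$ is the set of restrictions of these maps to $L$). Two metric fractals $(X,\mathcal F_X)$, $(Y,\mathcal F_Y)$ are isometrically equivalent if there is a surjective isometry $h:X\to Y$ with $\mathcal F_Y=\{h\circ f\circ h^{-1}:f\in\mathcal F_X\}$. $\ell_2$ is the real Hilbert space of square-summable sequences. *)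

theory Defs
  imports "HOL-Analysis.Analysis"
begin

section \<open>The Hilbert space of square-summable real sequences\<close>

typedef ell2 = "{x :: nat \<Rightarrow> real. summable (\<lambda>n. (x n)\<^sup>2)}"
  morphisms ell2_nth Abs_ell2
  by (rule exI[of _ "\<lambda>_. 0"]) simp

setup_lifting type_definition_ell2

lemma summable_mult_of_squares:
  fixes x y :: "nat \<Rightarrow> real"
  assumes "summable (\<lambda>n. (x n)\<^sup>2)" "summable (\<lambda>n. (y n)\<^sup>2)"
  shows "summable (\<lambda>n. x n * y n)"
proof (rule summable_comparison_test')
  show "summable (\<lambda>n. (x n)\<^sup>2 + (y n)\<^sup>2)"
    using assms by (rule summable_add)
  fix n :: nat
  have "\<bar>x n\<bar> * \<bar>y n\<bar> \<le> (x n)\<^sup>2 + (y n)\<^sup>2"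
  proof -
    have "2 * (\<bar>x n\<bar> * \<bar>y n\<bar>) \<le> (x n)\<^sup>2 + (y n)\<^sup>2"
      using sum_squares_bound[of "\<bar>x n\<bar>" "\<bar>y n\<bar>"] by simp
    moreover have "0 \<le> \<bar>x n\<bar> * \<bar>y n\<bar>" by simp
    ultimately show ?thesis by linarith
  qed
  then show "norm (x n * y n) \<le> (x n)\<^sup>2 + (y n)\<^sup>2"
    by (simp add: abs_mult)
qed

lemma summable_add_square:
  fixes x y :: "nat \<Rightarrow> real"
  assumes "summable (\<lambda>n. (x n)\<^sup>2)" "summable (\<lambda>n. (y n)\<^sup>2)"
  shows "summable (\<lambda>n. (x n + y n)\<^sup>2)"
proof -
  have "summable (\<lambda>n. (x n)\<^sup>2 + (y n)\<^sup>2 + 2 * (x n * y n))"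
    using assms summable_mult_of_squares[OF assms]
    by (intro summable_add summable_mult)
  then show ?thesis by (simp add: power2_sum algebra_simps)
qed

lemma summable_ell2_nth_square [simp]: "summable (\<lambda>n. (ell2_nth x n)\<^sup>2)"
  using ell2_nth[of x] by simp

instantiation ell2 :: real_vector
begin

lift_definition zero_ell2 :: ell2 is "\<lambda>_. 0" by simp

lift_definition plus_ell2 :: "ell2 \<Rightarrow> ell2 \<Rightarrow> ell2" is "\<lambda>x y n. x n + y n"
  by (rule summable_add_square)

lift_definition uminus_ell2 :: "ell2 \<Rightarrow> ell2" is "\<lambda>x n. - x n" by simp

lift_definition minus_ell2 :: "ell2 \<Rightarrow> ell2 \<Rightarrow> ell2" is "\<lambda>x y n. x n - y n"
  using summable_add_square[of _ "\<lambda>n. - y n" for y] by fastforce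

lift_definition scaleR_ell2 :: "real \<Rightarrow> ell2 \<Rightarrow> ell2" is "\<lambda>r x n. r * x n"
  by (simp add: power_mult_distrib summable_mult)

instance
  by standard (transfer; auto simp: algebra_simps)+

end

instantiation ell2 :: real_inner
begin

lift_definition inner_ell2 :: "ell2 \<Rightarrow> ell2 \<Rightarrow> real" is "\<lambda>x y. \<Sum>n. x n * y n" .

definition norm_ell2 :: "ell2 \<Rightarrow> real" where
  "norm_ell2 x = sqrt (inner x x)"

definition dist_ell2 :: "ell2 \<Rightarrow> ell2 \<Rightarrow> real" where
  "dist_ell2 x y = norm (x - y)"

definition sgn_ell2 :: "ell2 \<Rightarrow> ell2" where
  "sgn_ell2 x = inverse (norm x) *\<^sub>R x"

definition uniformity_ell2 :: "(ell2 \<times> ell2) filter" where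
  "uniformity_ell2 = (INF e\<in>{0<..}. principal {(x, y). dist x y < e})"

definition open_ell2 :: "ell2 set \<Rightarrow> bool" where
  "open_ell2 U \<longleftrightarrow> (\<forall>x\<in>U. eventually (\<lambda>(x', y). x' = x \<longrightarrow> y \<in> U) uniformity)"

instance
proof
  fix x y z :: ell2 and r :: real
  show "inner x y = inner y x"
    by transfer (simp add: mult.commute)
  show "inner (x + y) z = inner x z + inner y z"
    by transfer (simp add: distrib_right suminf_add summable_mult_of_squares)
  show "inner (r *\<^sub>R x) y = r * inner x y"
    by transfer (simp add: mult.assoc suminf_mult summable_mult_of_squares)
  show "0 \<le> inner x x"
    by transfer (simp add: suminf_nonneg summable_mult_of_squares)
  show "inner x x = 0 \<longleftrightarrow> x = 0"
  proof transfer
    fix x :: "nat \<Rightarrow> real"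
    assume "summable (\<lambda>n. (x n)\<^sup>2)"
    then have "(\<Sum>n. (x n)\<^sup>2) = 0 \<longleftrightarrow> (\<forall>n. (x n)\<^sup>2 = 0)"
      by (intro suminf_eq_zero_iff) auto
    then show "(\<Sum>n. x n * x n) = 0 \<longleftrightarrow> x = (\<lambda>_. 0)"
      by (auto simp: power2_eq_square)
  qed
qed (fact norm_ell2_def dist_ell2_def sgn_ell2_def uniformity_ell2_def open_ell2_def)+

end

lemma norm_ell2_eq: "norm x = sqrt (\<Sum>n. (ell2_nth x n)\<^sup>2)"
  unfolding norm_ell2_def by transfer (simp add: power2_eq_square)

lemma sum_ell2_nth_square_le: "(\<Sum>i<k. (ell2_nth x i)\<^sup>2) \<le> (norm x)\<^sup>2"
proof -
  have "(\<Sum>i<k. (ell2_nth x i)\<^sup>2) \<le> (\<Sum>i. (ell2_nth x i)\<^sup>2)"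
    by (rule sum_le_suminf) auto
  then show ?thesis by (simp add: norm_ell2_eq suminf_nonneg)
qed

lemma ell2_nth_minus: "ell2_nth (x - y) n = ell2_nth x n - ell2_nth y n"
  by transfer simp

lemma abs_ell2_nth_le_norm: "\<bar>ell2_nth x n\<bar> \<le> norm x"
proof -
  have "(ell2_nth x n)\<^sup>2 \<le> (\<Sum>i<Suc n. (ell2_nth x i)\<^sup>2)"
    by (simp add: sum_nonneg)
  also have "\<dots> \<le> (norm x)\<^sup>2" by (rule sum_ell2_nth_square_le)
  finally show ?thesis by (simp flip: abs_le_square_iff)
qed

instance ell2 :: complete_space
proof
  fix X :: "nat \<Rightarrow> ell2"
  assume X: "Cauchy X"
  have "Cauchy (\<lambda>m. ell2_nth (X m) i)" for i
  proof (rule metric_CauchyI)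
    fix e :: real assume "0 < e"
    with X obtain N where N: "\<And>m n. N \<le> m \<Longrightarrow> N \<le> n \<Longrightarrow> dist (X m) (X n) < e"
      unfolding Cauchy_def by meson
    have "dist (ell2_nth (X m) i) (ell2_nth (X n) i) < e" if "N \<le> m" "N \<le> n" for m n
      using N[OF that] abs_ell2_nth_le_norm[of "X m - X n" i]
      by (simp add: dist_norm ell2_nth_minus)
    then show "\<exists>N. \<forall>m\<ge>N. \<forall>n\<ge>N. dist (ell2_nth (X m) i) (ell2_nth (X n) i) < e"
      by blast
  qed
  then have "\<forall>i. \<exists>l. (\<lambda>m. ell2_nth (X m) i) \<longlonglongrightarrow> l"
    by (simp add: Cauchy_convergent_iff convergent_def)
  then obtain a where a: "\<And>i. (\<lambda>m. ell2_nth (X m) i) \<longlonglongrightarrow> a i"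
    by metis
  have bound: "\<exists>N. \<forall>m\<ge>N. \<forall>k. (\<Sum>i<k. (ell2_nth (X m) i - a i)\<^sup>2) \<le> e\<^sup>2" if "0 < e" for e
  proof -
    from X that obtain N where N: "\<And>m n. N \<le> m \<Longrightarrow> N \<le> n \<Longrightarrow> dist (X m) (X n) < e"
      unfolding Cauchy_def by meson
    have "(\<Sum>i<k. (ell2_nth (X m) i - a i)\<^sup>2) \<le> e\<^sup>2" if m: "N \<le> m" for m k
    proof (rule LIMSEQ_le_const2)
      show "(\<lambda>n. \<Sum>i<k. (ell2_nth (X m) i - ell2_nth (X n) i)\<^sup>2)
              \<longlonglongrightarrow> (\<Sum>i<k. (ell2_nth (X m) i - a i)\<^sup>2)"
        by (intro tendsto_intros a)
      have "(\<Sum>i<k. (ell2_nth (X m) i - ell2_nth (X n) i)\<^sup>2) \<le> e\<^sup>2" if "N \<le> n" for n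
      proof -
        have "(\<Sum>i<k. (ell2_nth (X m - X n) i)\<^sup>2) \<le> (norm (X m - X n))\<^sup>2"
          by (rule sum_ell2_nth_square_le)
        also have "\<dots> \<le> e\<^sup>2"
          using N[OF m that] by (intro power_mono) (auto simp: dist_norm)
        finally show ?thesis by (simp add: ell2_nth_minus)
      qed
      then show "\<exists>N. \<forall>n\<ge>N. (\<Sum>i<k. (ell2_nth (X m) i - ell2_nth (X n) i)\<^sup>2) \<le> e\<^sup>2"
        by blast
    qed
    then show ?thesis by blast
  qed
  have diff: "summable (\<lambda>i. (ell2_nth (X m) i - a i)\<^sup>2)"
    if "\<forall>k. (\<Sum>i<k. (ell2_nth (X m) i - a i)\<^sup>2) \<le> c" for m c
    using that by (intro summableI_nonneg_bounded[where x = c]) auto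
  have sa: "summable (\<lambda>i. (a i)\<^sup>2)"
  proof -
    obtain m where "summable (\<lambda>i. (ell2_nth (X m) i - a i)\<^sup>2)"
      using bound[of 1] diff by (metis le_refl zero_less_one)
    then have "summable (\<lambda>i. (a i - ell2_nth (X m) i)\<^sup>2)"
      by (simp add: power2_commute)
    from summable_add_square[OF this summable_ell2_nth_square[of "X m"]]
    show ?thesis by simp
  qed
  define A where "A = Abs_ell2 a"
  have A: "ell2_nth A = a"
    using sa by (simp add: A_def Abs_ell2_inverse)
  have "X \<longlonglongrightarrow> A"
  proof (rule metric_LIMSEQ_I)
    fix e :: real assume e: "0 < e"
    then obtain N where N: "\<And>m k. N \<le> m \<Longrightarrow> (\<Sum>i<k. (ell2_nth (X m) i - a i)\<^sup>2) \<le> (e/2)\<^sup>2"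
      using bound[of "e/2"] by (metis half_gt_zero)
    have "dist (X m) A < e" if "N \<le> m" for m
    proof -
      have "(\<Sum>i. (ell2_nth (X m) i - a i)\<^sup>2) \<le> (e/2)\<^sup>2"
        using N[OF that] diff by (intro suminf_le_const) blast+
      then have "dist (X m) A \<le> sqrt ((e/2)\<^sup>2)"
        unfolding dist_norm norm_ell2_eq ell2_nth_minus A by (rule real_sqrt_le_mono)
      with e show ?thesis by simp
    qed
    then show "\<exists>N. \<forall>m\<ge>N. dist (X m) A < e" by blast
  qed
  then show "convergent X" by (auto simp: convergent_def)
qed


section \<open>Metric fractals\<close>

text \<open>
  A self-map of \<open>m\<close> is a member of \<open>mspace m \<rightarrow>\<^sub>E mspace m\<close>: fixing the value \<open>undefined\<close> off the
  carrier makes equality of HOL functions coincide with equality of maps on the carrier, so that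
  equality of families of self-maps has its intended meaning.
\<close>

text \<open>The supremum is taken in the extended nonnegative reals, where the supremum of the empty
  set (the case of a one-point space) is \<open>0\<close>.\<close>

definition Lip :: "'a metric \<Rightarrow> ('a \<Rightarrow> 'a) \<Rightarrow> ennreal" where
  "Lip m f = (SUP (x, y) \<in> {(x, y). x \<in> mspace m \<and> y \<in> mspace m \<and> x \<noteq> y}.
                ennreal (mdist m (f x) (f y) / mdist m x y))"

definition contracting_self_map :: "'a metric \<Rightarrow> ('a \<Rightarrow> 'a) \<Rightarrow> bool" where
  "contracting_self_map m f \<longleftrightarrow> f \<in> mspace m \<rightarrow>\<^sub>E mspace m \<and> Lip m f < 1"

definition metric_fractal :: "'a metric \<Rightarrow> ('a \<Rightarrow> 'a) set \<Rightarrow> bool" where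
  "metric_fractal m F \<longleftrightarrow>
     mspace m \<noteq> {} \<and> compact_space (mtopology_of m) \<and>
     finite F \<and> (\<forall>f\<in>F. contracting_self_map m f) \<and>
     mspace m = (\<Union>f\<in>F. f ` mspace m)"

definition ultrametric :: "'a metric \<Rightarrow> bool" where
  "ultrametric m \<longleftrightarrow>
     (\<forall>x\<in>mspace m. \<forall>y\<in>mspace m. \<forall>z\<in>mspace m.
        mdist m x z \<le> max (mdist m x y) (mdist m y z))"

definition ultrametric_fractal :: "'a metric \<Rightarrow> ('a \<Rightarrow> 'a) set \<Rightarrow> bool" where
  "ultrametric_fractal m F \<longleftrightarrow> metric_fractal m F \<and> ultrametric m"

definition fractal_in :: "'a metric \<Rightarrow> 'a set \<Rightarrow> ('a \<Rightarrow> 'a) set \<Rightarrow> bool" where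
  "fractal_in M L G \<longleftrightarrow>
     mcomplete_of M \<and> L \<subseteq> mspace M \<and> metric_fractal (submetric M L) G \<and>
     (\<forall>g\<in>G. \<exists>f. contracting_self_map M f \<and> g = restrict f L)"

definition isometrically_equivalent ::
    "'a metric \<Rightarrow> ('a \<Rightarrow> 'a) set \<Rightarrow> 'b metric \<Rightarrow> ('b \<Rightarrow> 'b) set \<Rightarrow> bool" where
  "isometrically_equivalent X FX Y FY \<longleftrightarrow>
     (\<exists>h. h ` mspace X = mspace Y \<and>
          (\<forall>x\<in>mspace X. \<forall>y\<in>mspace X. mdist Y (h x) (h y) = mdist X x y) \<and>
          FY = {restrict (h \<circ> f \<circ> inv_into (mspace X) h) (mspace Y) | f. f \<in> FX})"

end

theory Submission
  imports Defs
begin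

text \<open>
  The fractal is transported along an isometric embedding \<open>h\<close> of \<open>X\<close> into the Hilbert space, and
  each transported map is extended to the whole space without increasing its Lipschitz constant.

  The embedding comes from the tree of balls of an ultrametric space. For each distance \<open>t > 0\<close> that
  occurs in \<open>X\<close>, the open balls of radius \<open>t\<close> partition \<open>X\<close>, and two points lie in the same one
  exactly when their distance is less than \<open>t\<close>. Give every pair of a level \<open>t\<close> and a ball of radius
  \<open>t\<close> its own coordinate, and let a point have the value \<open>sqrt (w t / 2)\<close> at its ball of level \<open>t\<close>
  and \<open>0\<close> at the other balls of that level. Two points at distance \<open>T\<close> then differ in two coordinates
  for each level \<open>t \<le> T\<close> and in none above, so their squared distance is the sum of \<open>w t\<close> over the
  levels \<open>t \<le> T\<close>. With \<open>w t\<close> the difference between \<open>t\<^sup>2\<close> and the square of the next smaller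
  level, this sum telescopes to \<open>T\<^sup>2\<close>. Total boundedness makes every level have finitely many
  balls and lets the levels accumulate at \<open>0\<close> only; hence there are countably many coordinates, next
  smaller levels exist, and the telescoping series converges
  (\<open>ultrametric_isometric_embedding_ell2\<close>).

  The extension is Kirszbraun's theorem (\<open>lipschitz_extension_into_compact_convex\<close>). As the image
  \<open>L\<close> of \<open>X\<close> is compact, so is its closed convex hull \<open>K\<close>, and the extension can be made to take
  values in \<open>K\<close>. This reduces everything to extending a map from finitely many points to one
  more point: compactness of \<open>K\<close> passes from finite sets to arbitrary ones, and Zorn's lemma from one
  further point to the whole space.
\<close>

section \<open>Extending Lipschitz maps between inner product spaces\<close>

text \<open>
  A weighted second moment is its pairwise part plus the squared norm of the barycentre. This is what
  lets an inequality between pairwise distances be transferred to distances from a common point.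
\<close>

lemma weighted_variance:
  fixes z :: "'i \<Rightarrow> 'a::real_inner"
  assumes t: "(\<Sum>i\<in>I. t i) = (1::real)"
  shows "(\<Sum>i\<in>I. \<Sum>j\<in>I. t i * t j * (norm (z i - z j))\<^sup>2)
       = 2 * (\<Sum>i\<in>I. t i * (norm (z i))\<^sup>2) - 2 * (norm (\<Sum>i\<in>I. t i *\<^sub>R z i))\<^sup>2"
proof -
  let ?V = "\<Sum>i\<in>I. t i * (norm (z i))\<^sup>2"
  have e: "t i * t j * (norm (z i - z j))\<^sup>2
      = (t i * (norm (z i))\<^sup>2) * t j + t i * (t j * (norm (z j))\<^sup>2)
        - 2 * ((t i *\<^sub>R z i) \<bullet> (t j *\<^sub>R z j))" for i j
    by (simp add: power2_norm_eq_inner inner_diff_left inner_diff_right inner_commute algebra_simps)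
  have a: "(\<Sum>i\<in>I. \<Sum>j\<in>I. (t i * (norm (z i))\<^sup>2) * t j) = ?V"
    using t by (simp flip: sum_product)
  have b: "(\<Sum>i\<in>I. \<Sum>j\<in>I. t i * (t j * (norm (z j))\<^sup>2)) = ?V"
    using t by (simp flip: sum_product)
  have c: "(\<Sum>i\<in>I. \<Sum>j\<in>I. (t i *\<^sub>R z i) \<bullet> (t j *\<^sub>R z j)) = (norm (\<Sum>i\<in>I. t i *\<^sub>R z i))\<^sup>2"
    by (simp only: power2_norm_eq_inner flip: inner_sum_left inner_sum_right)
  show ?thesis
    unfolding e sum.distrib sum_subtractf a b
    by (simp only: c flip: sum_distrib_left)
qed

text \<open>
  The square of the positive part has derivative \<open>2 * max 0 u\<close>, which is Lipschitz with constant \<open>2\<close>;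
  this is the resulting second-order upper bound.
\<close>

lemma positive_part_square_le:
  fixes u v :: real
  shows "(max 0 v)\<^sup>2 \<le> (max 0 u)\<^sup>2 + 2 * max 0 u * (v - u) + (v - u)\<^sup>2"
proof -
  have "(max 0 u + (v - u))\<^sup>2 = (max 0 u)\<^sup>2 + 2 * max 0 u * (v - u) + (v - u)\<^sup>2"
    by (simp add: power2_sum)
  moreover have "(max 0 v)\<^sup>2 \<le> (max 0 u + (v - u))\<^sup>2"
    by (cases "u \<ge> 0"; cases "v \<ge> 0") (auto simp: max_def power_mono)
  ultimately show ?thesis by simp
qed

text \<open>
  The finite core of Kirszbraun's theorem: the balls around the \<open>y i\<close> with radii \<open>norm (p - x i)\<close>
  have a common point in \<open>K\<close>. Let \<open>q\<close> minimise over \<open>K\<close> the penalty \<open>\<phi>\<close>, the sum of the squares of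
  the excesses \<open>w i\<close> of the squared distances over the squared radii. If some excess is positive,
  the gradient of \<open>\<phi>\<close> at \<open>q\<close> is a positive multiple of \<open>q - c\<close>, where \<open>c \<in> K\<close> is the mean of the
  \<open>y i\<close> with weights \<open>w i\<close>, so minimality forces \<open>q = c\<close>. By \<open>weighted_variance\<close> the
  weighted mean of \<open>(norm (q - y i))\<^sup>2\<close> is then at most that of \<open>(norm (p - x i))\<^sup>2\<close>, although
  only indices where the former is the larger one carry weight: a contradiction.
\<close>

lemma nonexpansive_finite_one_point_extension:
  fixes x :: "'i \<Rightarrow> 'a::real_inner" and y :: "'i \<Rightarrow> 'b::real_inner"
  assumes I: "finite I" and K: "compact K" "convex K" "K \<noteq> {}" "y ` I \<subseteq> K"
    and le: "\<And>i j. i \<in> I \<Longrightarrow> j \<in> I \<Longrightarrow> norm (y i - y j) \<le> norm (x i - x j)"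
  shows "\<exists>q\<in>K. \<forall>i\<in>I. norm (q - y i) \<le> norm (p - x i)"
proof -
  define u where "u q i = (norm (q - y i))\<^sup>2 - (norm (p - x i))\<^sup>2" for q i
  define \<phi> where "\<phi> q = (\<Sum>i\<in>I. (max 0 (u q i))\<^sup>2)" for q
  have "continuous_on K \<phi>"
    unfolding \<phi>_def u_def by (intro continuous_intros)
  then obtain q where q: "q \<in> K" and min: "\<And>r. r \<in> K \<Longrightarrow> \<phi> q \<le> \<phi> r"
    using continuous_attains_inf[OF K(1,3)] by blast
  define w where "w i = max 0 (u q i)" for i
  define W where "W = sum w I"
  have w0: "w i \<ge> 0" for i by (simp add: w_def)
  show ?thesis
  proof (cases "W = 0")
    case True
    then have "\<forall>i\<in>I. u q i \<le> 0"
      using sum_nonneg_eq_0_iff[OF I, of w] w0 unfolding W_def w_def by (auto simp: max_def split: if_splits)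
    then have "\<forall>i\<in>I. norm (q - y i) \<le> norm (p - x i)"
      by (auto simp: u_def intro: power2_le_imp_le)
    with q show ?thesis by blast
  next
    case False
    then have W: "W > 0" using sum_nonneg[of I w] w0 unfolding W_def by (simp add: less_le)
    define t where "t i = w i / W" for i
    have t1: "sum t I = 1" using W by (simp add: t_def W_def flip: sum_divide_distrib)
    have t0: "t i \<ge> 0" for i using w0 W by (simp add: t_def)
    define c where "c = (\<Sum>i\<in>I. t i *\<^sub>R y i)"
    have cK: "c \<in> K"
      unfolding c_def using K(4) t0 by (intro convex_sum[OF I K(2) t1]) auto
    define v where "v = c - q"
    define C where "C = (\<Sum>i\<in>I. (2 * \<bar>(q - y i) \<bullet> v\<bar> + (norm v)\<^sup>2)\<^sup>2)"
    have "(\<Sum>i\<in>I. w i *\<^sub>R (q - y i)) = W *\<^sub>R q - W *\<^sub>R c"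
    proof -
      have "W *\<^sub>R c = (\<Sum>i\<in>I. w i *\<^sub>R y i)"
        using W by (simp add: c_def t_def scaleR_sum_right)
      moreover have "W *\<^sub>R q = (\<Sum>i\<in>I. w i *\<^sub>R q)"
        by (simp add: W_def scaleR_sum_left)
      ultimately show ?thesis by (simp add: scaleR_diff_right sum_subtractf)
    qed
    then have "(\<Sum>i\<in>I. w i *\<^sub>R (q - y i)) = - (W *\<^sub>R v)"
      by (simp add: v_def scaleR_diff_right)
    then have "(\<Sum>i\<in>I. w i *\<^sub>R (q - y i)) \<bullet> v = - (W *\<^sub>R v) \<bullet> v" by simp
    then have wv: "(\<Sum>i\<in>I. w i * ((q - y i) \<bullet> v)) = - W * (norm v)\<^sup>2"
      by (simp only: inner_sum_left inner_scaleR_left inner_minus_left power2_norm_eq_inner)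
    \<comment> \<open>Moving from \<open>q\<close> towards \<open>c\<close> by the fraction \<open>s\<close> changes \<open>\<phi>\<close> by at most
      \<open>- 4 s W (norm v)\<^sup>2\<close> plus a term of order \<open>s\<^sup>2\<close>; minimality of \<open>q\<close> bounds the first by the
      second, and \<open>s \<rightarrow> 0\<close> gives \<open>v = 0\<close>.\<close>
    have bound: "4 * W * (norm v)\<^sup>2 \<le> s * (2 * W * (norm v)\<^sup>2 + C)" if s: "0 < s" "s \<le> 1" for s
    proof -
      have r: "q + s *\<^sub>R v \<in> K"
        using convexD_alt[OF K(2) q cK, of s] s by (simp add: v_def algebra_simps)
      have du: "u (q + s *\<^sub>R v) i - u q i = 2 * s * ((q - y i) \<bullet> v) + s\<^sup>2 * (norm v)\<^sup>2" for i
        unfolding u_def power2_norm_eq_inner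
        by (simp add: algebra_simps inner_commute power2_eq_square)
      have "(max 0 (u (q + s *\<^sub>R v) i))\<^sup>2
          \<le> (w i)\<^sup>2 + 4 * s * (w i * ((q - y i) \<bullet> v)) + 2 * s\<^sup>2 * (norm v)\<^sup>2 * w i
             + s\<^sup>2 * (2 * \<bar>(q - y i) \<bullet> v\<bar> + (norm v)\<^sup>2)\<^sup>2" for i
      proof -
        let ?b = "(q - y i) \<bullet> v"
        let ?e = "2 * s * ?b + s\<^sup>2 * (norm v)\<^sup>2"
        have "\<bar>?e\<bar> \<le> 2 * s * \<bar>?b\<bar> + s * (norm v)\<^sup>2"
        proof -
          have "s\<^sup>2 * (norm v)\<^sup>2 \<le> s * (norm v)\<^sup>2"
            using s by (intro mult_right_mono) (auto simp: power2_eq_square mult_left_le)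
          moreover have "\<bar>2 * s * ?b\<bar> = 2 * s * \<bar>?b\<bar>" using s by (simp add: abs_mult)
          moreover have "\<bar>s\<^sup>2 * (norm v)\<^sup>2\<bar> = s\<^sup>2 * (norm v)\<^sup>2" by simp
          ultimately show ?thesis using abs_triangle_ineq[of "2 * s * ?b" "s\<^sup>2 * (norm v)\<^sup>2"] by linarith
        qed
        also have "\<dots> = s * (2 * \<bar>?b\<bar> + (norm v)\<^sup>2)" by (simp add: algebra_simps)
        finally have "\<bar>?e\<bar>\<^sup>2 \<le> (s * (2 * \<bar>?b\<bar> + (norm v)\<^sup>2))\<^sup>2"
          by (intro power_mono) auto
        then have "?e\<^sup>2 \<le> s\<^sup>2 * (2 * \<bar>?b\<bar> + (norm v)\<^sup>2)\<^sup>2"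
          by (simp add: power_mult_distrib)
        moreover have "2 * w i * ?e = 4 * s * (w i * ?b) + 2 * s\<^sup>2 * (norm v)\<^sup>2 * w i"
          by (simp add: algebra_simps)
        ultimately show ?thesis
          using positive_part_square_le[of "u (q + s *\<^sub>R v) i" "u q i"] unfolding du w_def by linarith
      qed
      then have "\<phi> (q + s *\<^sub>R v)
          \<le> (\<Sum>i\<in>I. (w i)\<^sup>2 + 4 * s * (w i * ((q - y i) \<bullet> v)) + 2 * s\<^sup>2 * (norm v)\<^sup>2 * w i
             + s\<^sup>2 * (2 * \<bar>(q - y i) \<bullet> v\<bar> + (norm v)\<^sup>2)\<^sup>2)"
        unfolding \<phi>_def by (rule sum_mono)
      also have "\<dots> = \<phi> q - 4 * s * (W * (norm v)\<^sup>2) + 2 * s\<^sup>2 * (norm v)\<^sup>2 * W + s\<^sup>2 * C"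
        unfolding sum.distrib sum_distrib_left[symmetric] wv W_def[symmetric] C_def[symmetric]
        by (simp add: \<phi>_def w_def)
      finally have "4 * s * (W * (norm v)\<^sup>2) \<le> 2 * s\<^sup>2 * (norm v)\<^sup>2 * W + s\<^sup>2 * C"
        using min[OF r] by linarith
      then have "s * (4 * W * (norm v)\<^sup>2) \<le> s * (s * (2 * W * (norm v)\<^sup>2 + C))"
        by (simp add: algebra_simps power2_eq_square)
      then show ?thesis using s by simp
    qed
    have "((\<lambda>s. s * (2 * W * (norm v)\<^sup>2 + C)) \<longlongrightarrow> 0 * (2 * W * (norm v)\<^sup>2 + C)) (at_right 0)"
      by (intro tendsto_intros)
    moreover have "eventually (\<lambda>s. 4 * W * (norm v)\<^sup>2 \<le> s * (2 * W * (norm v)\<^sup>2 + C)) (at_right 0)"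
      unfolding eventually_at_right_field using bound by (intro exI[of _ 1]) auto
    ultimately have "4 * W * (norm v)\<^sup>2 \<le> 0 * (2 * W * (norm v)\<^sup>2 + C)"
      by (intro tendsto_lowerbound) auto
    then have "v = 0" using W by (simp add: mult_le_0_iff)
    then have qc: "(\<Sum>i\<in>I. t i *\<^sub>R (q - y i)) = 0"
      using t1 by (simp add: v_def c_def scaleR_diff_right sum_subtractf flip: scaleR_sum_left)
    have "2 * (\<Sum>i\<in>I. t i * (norm (q - y i))\<^sup>2)
        = (\<Sum>i\<in>I. \<Sum>j\<in>I. t i * t j * (norm (y i - y j))\<^sup>2)"
      using weighted_variance[OF t1, of "\<lambda>i. q - y i"] qc by (simp add: norm_minus_commute)
    also have "\<dots> \<le> (\<Sum>i\<in>I. \<Sum>j\<in>I. t i * t j * (norm (x i - x j))\<^sup>2)"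
      using le t0 by (intro sum_mono mult_left_mono power_mono) auto
    also have "\<dots> \<le> 2 * (\<Sum>i\<in>I. t i * (norm (p - x i))\<^sup>2)"
      using weighted_variance[OF t1, of "\<lambda>i. p - x i"] by (simp add: norm_minus_commute)
    finally have "(\<Sum>i\<in>I. t i * u q i) \<le> 0"
      by (simp add: u_def right_diff_distrib sum_subtractf)
    moreover have "t i * u q i = (w i)\<^sup>2 / W" for i
      by (simp add: t_def w_def power2_eq_square max_def)
    moreover have "t i * u q i \<ge> 0" for i
      by (simp add: t_def w_def max_def W less_imp_le)
    ultimately have "\<forall>i\<in>I. (w i)\<^sup>2 / W = 0"
      using sum_nonneg_eq_0_iff[OF I, of "\<lambda>i. t i * u q i"] sum_nonneg[of I "\<lambda>i. t i * u q i"] by fastforce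
    then have "W = 0" using W by (auto simp: W_def)
    with False show ?thesis by blast
  qed
qed

text \<open>
  Zorn's lemma is applied to graphs rather than to partial functions: the Lipschitz inequality makes a
  relation single-valued, and being a \<open>c\<close>-Lipschitz relation is a condition on pairs of elements and
  hence stable under unions of chains. A maximal relation is total, because the balls that
  constrain the value at a further point have a common point in \<open>K\<close> as soon as any finitely many of
  them have one.
\<close>

lemma lipschitz_extension_into_compact_convex:
  fixes f :: "'a::real_inner \<Rightarrow> 'b::real_inner"
  assumes f: "c-lipschitz_on A f" "f ` A \<subseteq> K" and K: "compact K" "convex K" "K \<noteq> {}"
  shows "\<exists>g. c-lipschitz_on UNIV g \<and> (\<forall>x\<in>A. g x = f x)"
proof -
  have c: "c \<ge> 0" using f(1) lipschitz_on_nonneg by blast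
  define lip where "lip R \<longleftrightarrow> (\<forall>(a, b)\<in>R. b \<in> K \<and> (\<forall>(a', b')\<in>R. dist b b' \<le> c * dist a a'))"
    for R :: "('a \<times> 'b) set"
  define \<A> where "\<A> = {R. (\<lambda>a. (a, f a)) ` A \<subseteq> R \<and> lip R}"
  have "(\<lambda>a. (a, f a)) ` A \<in> \<A>"
    using f unfolding \<A>_def lip_def by (auto simp: lipschitz_on_def)
  moreover have "\<Union>\<C> \<in> \<A>" if ne: "\<C> \<noteq> {}" and ch: "subset.chain \<A> \<C>" for \<C>
  proof -
    have mem: "\<And>R. R \<in> \<C> \<Longrightarrow> R \<in> \<A>" using ch by (auto simp: subset_chain_def)
    have "(\<lambda>a. (a, f a)) ` A \<subseteq> \<Union>\<C>" using ne mem by (fastforce simp: \<A>_def)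
    moreover have "b \<in> K \<and> dist b b' \<le> c * dist a a'"
      if mems: "(a, b) \<in> R" "R \<in> \<C>" "(a', b') \<in> R'" "R' \<in> \<C>" for a b R a' b' R'
    proof -
      have "R \<subseteq> R' \<or> R' \<subseteq> R" using ch mems by (auto simp: subset_chain_def)
      then obtain S where "S \<in> \<C>" "(a, b) \<in> S" "(a', b') \<in> S" using mems by blast
      then show ?thesis using mem unfolding \<A>_def lip_def by blast
    qed
    ultimately show ?thesis unfolding \<A>_def lip_def by blast
  qed
  ultimately obtain R where R: "R \<in> \<A>" and max: "\<And>S. S \<in> \<A> \<Longrightarrow> R \<subseteq> S \<Longrightarrow> S = R"
    using subset_Zorn_nonempty[of \<A>] by blast
  have RK: "b \<in> K" if "(a, b) \<in> R" for a b
    using R that unfolding \<A>_def lip_def by blast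
  have Rd: "dist b b' \<le> c * dist a a'" if "(a, b) \<in> R" "(a', b') \<in> R" for a b a' b'
    using R that unfolding \<A>_def lip_def by blast
  have "\<exists>q. (p, q) \<in> R" for p
  proof -
    have "K \<inter> (\<Inter>(a, b)\<in>R. cball b (c * dist p a)) \<noteq> {}"
    proof (rule compact_imp_fip_image[OF K(1)])
      show "closed (case i of (a, b) \<Rightarrow> cball b (c * dist p a))" if "i \<in> R" for i
        by (auto split: prod.split)
      fix J assume J: "finite J" "J \<subseteq> R"
      \<comment> \<open>Scaling the domain by \<open>c\<close> turns the Lipschitz constant into \<open>1\<close>.\<close>
      have "\<exists>q\<in>K. \<forall>i\<in>J. norm (q - snd i) \<le> norm (c *\<^sub>R p - c *\<^sub>R fst i)"
      proof (rule nonexpansive_finite_one_point_extension[OF J(1) K])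
        show "snd ` J \<subseteq> K" using J RK by force
        show "norm (snd i - snd j) \<le> norm (c *\<^sub>R fst i - c *\<^sub>R fst j)" if "i \<in> J" "j \<in> J" for i j
          using that J Rd[of "fst i" "snd i" "fst j" "snd j"] c
          by (auto simp: dist_norm simp flip: scaleR_diff_right)
      qed
      then obtain q where "q \<in> K" "\<And>i. i \<in> J \<Longrightarrow> norm (q - snd i) \<le> norm (c *\<^sub>R p - c *\<^sub>R fst i)"
        by blast
      then have "q \<in> K \<inter> (\<Inter>(a, b)\<in>J. cball b (c * dist p a))"
        using c by (force simp: dist_norm norm_minus_commute simp flip: scaleR_diff_right)
      then show "K \<inter> (\<Inter>(a, b)\<in>J. cball b (c * dist p a)) \<noteq> {}" by blast
    qed
    then obtain q where q: "q \<in> K" "\<And>a b. (a, b) \<in> R \<Longrightarrow> dist b q \<le> c * dist p a"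
      by fastforce
    have "insert (p, q) R \<in> \<A>"
    proof -
      have "lip (insert (p, q) R)"
        unfolding lip_def using q RK Rd by (auto simp: dist_commute)
      with R show ?thesis by (auto simp: \<A>_def)
    qed
    with max show ?thesis by blast
  qed
  then obtain g where g: "\<And>p. (p, g p) \<in> R" by metis
  have "g x = f x" if "x \<in> A" for x
    using Rd[OF g[of x], of x "f x"] that R by (auto simp: \<A>_def)
  moreover have "c-lipschitz_on UNIV g"
    using c Rd[OF g g] by (simp add: lipschitz_on_def)
  ultimately show ?thesis by blast
qed

text \<open>
  The convex hull of a finite net of \<open>S\<close> is compact, and every point of the convex hull of \<open>S\<close> is close
  to it, since a neighbourhood of a convex set is convex. So a finite net of the former is one,
  at a coarser scale, of the closed convex hull of \<open>S\<close>.
\<close>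

lemma compact_closure_convex_hull:
  fixes S :: "'a::{real_normed_vector, complete_space} set"
  assumes "compact S"
  shows "compact (closure (convex hull S))"
  unfolding compact_eq_totally_bounded
proof (intro conjI allI impI)
  show "complete (closure (convex hull S))"
    by (simp add: complete_eq_closed)
  fix e :: real assume e: "e > 0"
  obtain k where k: "finite k" "S \<subseteq> (\<Union>x\<in>k. ball x (e/4))" "k \<subseteq> S"
    using seq_compact_imp_totally_bounded[OF compact_imp_seq_compact[OF assms], rule_format, of "e/4"] e
    by auto
  have "compact (convex hull k)" using k(1) by (rule finite_imp_compact_convex_hull)
  then obtain l where l: "finite l" "convex hull k \<subseteq> (\<Union>x\<in>l. ball x (e/4))"
    using e unfolding compact_eq_totally_bounded by (meson zero_less_divide_iff zero_less_numeral)
  have "convex hull S \<subseteq> convex hull k + ball 0 (e/4)"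
  proof (rule hull_minimal)
    show "convex (convex hull k + ball 0 (e/4))"
      by (intro convex_set_plus) (auto simp: convex_convex_hull)
    show "S \<subseteq> convex hull k + ball 0 (e/4)"
    proof
      fix s assume "s \<in> S"
      then obtain x where x: "x \<in> k" "dist x s < e/4" using k by auto
      then have "s - x \<in> ball 0 (e/4)" by (simp add: dist_norm norm_minus_commute)
      with x hull_inc[of x k convex] show "s \<in> convex hull k + ball 0 (e/4)"
        by (metis add_diff_cancel_left' diff_add_cancel add.commute set_plus_intro)
    qed
  qed
  have "closure (convex hull S) \<subseteq> (\<Union>x\<in>l. ball x e)"
  proof
    fix z assume "z \<in> closure (convex hull S)"
    then obtain s where s: "s \<in> convex hull S" "dist s z < e/4"
      using e unfolding closure_approachable by (auto dest!: spec[of _ "e/4"])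
    then obtain a b where ab: "s = a + b" "a \<in> convex hull k" "norm b < e/4"
      using \<open>convex hull S \<subseteq> _\<close> by (auto elim!: set_plus_elim dest!: subsetD)
    then obtain x where x: "x \<in> l" "dist x a < e/4" using l by auto
    have "dist a s < e/4" using ab by (simp add: dist_norm)
    then have "dist x z < e"
      using x s e dist_triangle[of x z a] dist_triangle[of a z s] by linarith
    with x show "z \<in> (\<Union>x\<in>l. ball x e)" by auto
  qed
  with l show "\<exists>k. finite k \<and> closure (convex hull S) \<subseteq> (\<Union>x\<in>k. ball x e)" by blast
qed

section \<open>Isometric embedding of totally bounded ultrametric spaces\<close>

text \<open>
  The weights are \<open>w t = t\<^sup>2 - (p t)\<^sup>2\<close> with \<open>p t\<close> the predecessor of \<open>t\<close> in \<open>D\<close>. The predecessor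
  exists since \<open>D\<close> accumulates at most at \<open>0\<close>, which is itself in \<open>D\<close>. The partial sum over
  \<open>D \<inter> {e..T}\<close> telescopes to \<open>T\<^sup>2\<close> minus the square of an element of \<open>D\<close> below \<open>e\<close>.
\<close>

lemma telescoping_weights_for_squares:
  fixes D :: "real set"
  assumes D0: "0 \<in> D" "D \<subseteq> {0..}" and fin: "\<And>e. e > 0 \<Longrightarrow> finite (D \<inter> {e..})"
  shows "\<exists>w. (\<forall>t. w t \<ge> 0) \<and> (\<forall>T\<in>D. (w has_sum T\<^sup>2) (D \<inter> {0<..T}))"
proof -
  have "\<exists>p\<in>D. p < t \<and> (\<forall>s\<in>D. s < t \<longrightarrow> s \<le> p)" if t: "t > 0" for t
  proof (cases "\<exists>s\<in>D. 0 < s \<and> s < t")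
    case False
    then show ?thesis using D0 t by (intro bexI[of _ 0]) (auto simp: not_less)
  next
    case True
    then obtain s where s: "s \<in> D" "0 < s" "s < t" by blast
    let ?S = "D \<inter> {s..<t}"
    have "finite ?S" by (rule finite_subset[OF _ fin[OF s(2)]]) auto
    moreover have "?S \<noteq> {}" using s by auto
    ultimately have m: "Max ?S \<in> ?S" "\<And>r. r \<in> ?S \<Longrightarrow> r \<le> Max ?S"
      using Max_in Max_ge by blast+
    show ?thesis
    proof (intro bexI[of _ "Max ?S"] conjI ballI impI)
      fix r assume r: "r \<in> D" "r < t"
      show "r \<le> Max ?S"
      proof (cases "r < s")
        case True then show ?thesis using m(1) by simp
      next
        case False then show ?thesis using m(2)[of r] r by simp
      qed
    qed (use m in auto)
  qed
  then obtain p where p: "\<And>t. t > 0 \<Longrightarrow> p t \<in> D" "\<And>t. t > 0 \<Longrightarrow> p t < t"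
      "\<And>t s. t > 0 \<Longrightarrow> s \<in> D \<Longrightarrow> s < t \<Longrightarrow> s \<le> p t"
    by metis
  define w where "w t = (if t > 0 then t\<^sup>2 - (p t)\<^sup>2 else 0)" for t
  have p0: "p t \<ge> 0" if "t > 0" for t using p(1)[OF that] D0 by auto
  have w0: "w t \<ge> 0" for t
    using p(2)[of t] p0[of t] by (auto simp: w_def intro!: power_mono)
  have tele: "T\<^sup>2 - e\<^sup>2 \<le> sum w (D \<inter> {e..T}) \<and> sum w (D \<inter> {e..T}) \<le> T\<^sup>2"
    if e: "e > 0" and T: "T \<in> D" for e T
    using T
  proof (induction "card (D \<inter> {e..T})" arbitrary: T rule: less_induct)
    case less
    show ?case
    proof (cases "T < e")
      case True
      then show ?thesis using less.prems D0 by (auto intro!: power_mono)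
    next
      case False
      then have Tpos: "T > 0" using e by simp
      have eq: "D \<inter> {e..T} = insert T (D \<inter> {e..p T})"
        using p[OF Tpos] less.prems False p(3)[OF Tpos] by (force simp: le_less)
      have f: "finite (D \<inter> {e..p T})" by (rule finite_subset[OF _ fin[OF e]]) auto
      have ni: "T \<notin> D \<inter> {e..p T}" using p(2)[OF Tpos] by auto
      have "(p T)\<^sup>2 - e\<^sup>2 \<le> sum w (D \<inter> {e..p T}) \<and> sum w (D \<inter> {e..p T}) \<le> (p T)\<^sup>2"
        using less.hyps[of "p T"] p(1)[OF Tpos] f ni unfolding eq by simp
      moreover have "sum w (D \<inter> {e..T}) = T\<^sup>2 - (p T)\<^sup>2 + sum w (D \<inter> {e..p T})"
        unfolding eq using f ni Tpos by (simp add: w_def)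
      ultimately show ?thesis by linarith
    qed
  qed
  have "(w has_sum T\<^sup>2) (D \<inter> {0<..T})" if T: "T \<in> D" for T
    unfolding has_sum_def
  proof (rule tendstoI)
    fix \<epsilon> :: real assume \<epsilon>: "\<epsilon> > 0"
    define e where "e = sqrt (\<epsilon> / 2)"
    have e: "e > 0" "e\<^sup>2 < \<epsilon>" using \<epsilon> by (auto simp: e_def)
    show "\<forall>\<^sub>F Y in finite_subsets_at_top (D \<inter> {0<..T}). dist (sum w Y) (T\<^sup>2) < \<epsilon>"
      unfolding eventually_finite_subsets_at_top
    proof (intro exI[of _ "D \<inter> {e..T}"] conjI allI impI)
      show "finite (D \<inter> {e..T})" by (rule finite_subset[OF _ fin[OF e(1)]]) auto
      show "D \<inter> {e..T} \<subseteq> D \<inter> {0<..T}" using e by auto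
      fix Y assume Y: "finite Y \<and> D \<inter> {e..T} \<subseteq> Y \<and> Y \<subseteq> D \<inter> {0<..T}"
      have "sum w (D \<inter> {e..T}) \<le> sum w Y" using Y w0 by (intro sum_mono2) auto
      moreover have "sum w Y \<le> T\<^sup>2"
      proof (cases "Y = {}")
        case False
        define m where "m = Min Y"
        have m: "m > 0" using Y False Min_in[of Y] by (auto simp: m_def)
        have "finite (D \<inter> {m..T})" by (rule finite_subset[OF _ fin[OF m]]) auto
        then have "sum w Y \<le> sum w (D \<inter> {m..T})"
          using Y w0 by (intro sum_mono2) (auto simp: m_def)
        then show ?thesis using tele[OF m T] by linarith
      qed simp
      ultimately show "dist (sum w Y) (T\<^sup>2) < \<epsilon>"
        using tele[OF e(1) T] e(2) by (auto simp: dist_real_def)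
    qed
  qed
  with w0 show ?thesis by blast
qed

text \<open>
  Only differences of coordinate vectors are assumed to be square-summable, so that an embedding may be
  given by coordinates of infinite norm; subtracting the coordinates of a base point corrects this
  without changing distances.
\<close>

lemma ell2_from_countable_coordinates:
  fixes f :: "'x \<Rightarrow> 'i \<Rightarrow> real"
  assumes I: "countable I"
    and f: "\<And>x y. x \<in> M \<Longrightarrow> y \<in> M \<Longrightarrow> ((\<lambda>i. (f x i - f y i)\<^sup>2) has_sum (d x y)\<^sup>2) I"
    and d: "\<And>x y. d x y \<ge> 0"
  shows "\<exists>h :: 'x \<Rightarrow> ell2. \<forall>x\<in>M. \<forall>y\<in>M. dist (h x) (h y) = d x y"
proof (cases "M = {}")
  case False
  then obtain x0 where x0: "x0 \<in> M" by blast
  define N where "N = to_nat_on I ` I"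
  define g where "g x n = (if n \<in> N then f x (from_nat_into I n) else 0)" for x n
  have g: "(\<lambda>n. (g x n - g y n)\<^sup>2) sums (d x y)\<^sup>2" if "x \<in> M" "y \<in> M" for x y
  proof (rule has_sum_imp_sums)
    have inj: "inj_on (to_nat_on I) I" using I by (rule inj_on_to_nat_on)
    have "((\<lambda>n. (g x n - g y n)\<^sup>2) has_sum (d x y)\<^sup>2) N"
      unfolding N_def has_sum_reindex[OF inj]
      using f[OF that] by (rule has_sum_cong[THEN iffD1, rotated]) (use I in \<open>auto simp: g_def N_def\<close>)
    then show "((\<lambda>n. (g x n - g y n)\<^sup>2) has_sum (d x y)\<^sup>2) UNIV"
      by (rule has_sum_cong_neutral[THEN iffD1, rotated -1]) (auto simp: g_def)
  qed
  define h where "h x = Abs_ell2 (\<lambda>n. g x n - g x0 n)" for x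
  have h: "ell2_nth (h x) n = g x n - g x0 n" if "x \<in> M" for x n
    using g[OF that x0] by (simp add: h_def Abs_ell2_inverse sums_iff)
  have "dist (h x) (h y) = d x y" if "x \<in> M" "y \<in> M" for x y
    using g[OF that] d[of x y] that by (simp add: dist_norm norm_ell2_eq ell2_nth_minus h sums_iff)
  then show ?thesis by blast
qed auto

text \<open>
  Coordinates are indexed by pairs of a positive distance \<open>t\<close> and an open ball of radius \<open>t\<close>. The
  radius must be part of the index, since the same set may be a ball for several radii. A finite net
  at scale \<open>e\<close> realises every distance that is at least \<open>e\<close>, because in an ultrametric space moving
  both points by less than their distance does not change it.
\<close>

lemma (in Metric_space) ultrametric_isometric_embedding_ell2:
  assumes tb: "mtotally_bounded M"
    and um: "\<And>x y z. x \<in> M \<Longrightarrow> y \<in> M \<Longrightarrow> z \<in> M \<Longrightarrow> d x z \<le> max (d x y) (d y z)"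
  shows "\<exists>h :: 'a \<Rightarrow> ell2. \<forall>x\<in>M. \<forall>y\<in>M. dist (h x) (h y) = d x y"
proof (cases "M = {}")
  case False
  define D where "D = (\<lambda>(x, y). d x y) ` (M \<times> M)"
  have dD: "d x y \<in> D" if "x \<in> M" "y \<in> M" for x y using that by (auto simp: D_def)
  have net: "\<exists>k. finite k \<and> k \<subseteq> M \<and> (\<forall>x\<in>M. \<exists>a\<in>k. d a x < e)" if e: "e > 0" for e
  proof -
    obtain k where "finite k" "k \<subseteq> M" "M \<subseteq> (\<Union>a\<in>k. mball a e)"
      using tb[unfolded mtotally_bounded_def, rule_format, OF e] by blast
    then show ?thesis by (intro exI[of _ k]) fastforce
  qed
  have ball_eq: "mball x t = mball y t \<longleftrightarrow> d x y < t" if "x \<in> M" "y \<in> M" "t > 0" for x y t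
  proof
    assume "mball x t = mball y t"
    then have "y \<in> mball x t" using that by simp
    then show "d x y < t" by simp
  next
    assume a: "d x y < t"
    have "z \<in> mball x t \<longleftrightarrow> z \<in> mball y t" for z
      using um[of x y z] um[of y x z] a that by (auto simp: commute)
    then show "mball x t = mball y t" by blast
  qed
  have iso: "d x y = d a b"
    if "x \<in> M" "y \<in> M" "a \<in> M" "b \<in> M" "d a x < d x y" "d b y < d x y" for x y a b
    using um[of x a y] um[of a b y] um[of a x b] um[of x y b] that commute by (smt (verit))
  have fin: "finite (D \<inter> {e..})" if e: "e > 0" for e
  proof -
    obtain k where k: "finite k" "k \<subseteq> M" "\<forall>x\<in>M. \<exists>a\<in>k. d a x < e" using net[OF e] by blast
    have "D \<inter> {e..} \<subseteq> (\<lambda>(x, y). d x y) ` (k \<times> k)"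
    proof
      fix t assume "t \<in> D \<inter> {e..}"
      then obtain x y where xy: "x \<in> M" "y \<in> M" "t = d x y" "e \<le> d x y" by (auto simp: D_def)
      with k obtain a b where ab: "a \<in> k" "b \<in> k" "d a x < e" "d b y < e" by metis
      then have "d x y = d a b" using xy k by (intro iso) auto
      with ab xy show "t \<in> (\<lambda>(x, y). d x y) ` (k \<times> k)" by auto
    qed
    then show ?thesis using k(1) by (meson finite_SigmaI finite_imageI finite_subset)
  qed
  obtain x0 where "x0 \<in> M" using False by blast
  then have D0: "0 \<in> D" "D \<subseteq> {0..}" using dD[of x0 x0] by (auto simp: D_def)
  obtain w where w0: "\<And>t. w t \<ge> 0" and w: "\<And>T. T \<in> D \<Longrightarrow> (w has_sum T\<^sup>2) (D \<inter> {0<..T})"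
    using telescoping_weights_for_squares[OF D0 fin] by blast
  define I where "I = (SIGMA t : D \<inter> {0<..}. (\<lambda>x. mball x t) ` M)"
  have "countable I"
    unfolding I_def
  proof (rule countable_SIGMA)
    have "D \<inter> {0<..} \<subseteq> (\<Union>n. D \<inter> {inverse (real (Suc n))..})"
      using reals_Archimedean by (fastforce intro: less_imp_le)
    moreover have "countable (\<Union>n. D \<inter> {inverse (real (Suc n))..})"
      using fin by (intro countable_UN) (auto intro!: countable_finite)
    ultimately show "countable (D \<inter> {0<..})" by (rule countable_subset)
    fix t assume "t \<in> D \<inter> {0<..}"
    then have t: "t > 0" by simp
    obtain k where k: "finite k" "k \<subseteq> M" "\<forall>x\<in>M. \<exists>a\<in>k. d a x < t" using net[OF t] by blast
    have "(\<lambda>x. mball x t) ` M \<subseteq> (\<lambda>x. mball x t) ` k"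
    proof
      fix B assume "B \<in> (\<lambda>x. mball x t) ` M"
      then obtain x where x: "x \<in> M" "B = mball x t" by blast
      with k obtain a where "a \<in> k" "d a x < t" by blast
      moreover have "mball a t = mball x t" using ball_eq[of a x t] calculation x k t by blast
      ultimately show "B \<in> (\<lambda>x. mball x t) ` k" using x by blast
    qed
    with k(1) show "countable ((\<lambda>x. mball x t) ` M)"
      by (meson countable_finite finite_imageI finite_subset)
  qed
  moreover
  define f where "f x = (\<lambda>(t, B). if B = mball x t then sqrt (w t / 2) else 0)" for x
  have "((\<lambda>i. (f x i - f y i)\<^sup>2) has_sum (d x y)\<^sup>2) I" if x: "x \<in> M" and y: "y \<in> M" for x y
  proof -
    \<comment> \<open>\<open>A\<close> consists of the levels at which \<open>x\<close> and \<open>y\<close> lie in different balls. Each of them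
      contributes two coordinates, the ball of \<open>x\<close> and the ball of \<open>y\<close>.\<close>
    define A where "A = D \<inter> {0<..d x y}"
    let ?J = "\<lambda>x. (\<lambda>t. (t, mball x t)) ` A"
    have ne: "mball x t \<noteq> mball y t" if "t \<in> A" for t
      using ball_eq[OF x y, of t] that by (auto simp: A_def)
    have half: "((\<lambda>t. w t / 2) has_sum ((d x y)\<^sup>2 / 2)) A"
      using has_sum_cmult_left[OF w[OF dD[OF x y]], of "1/2"] by (simp add: A_def)
    have jx: "((\<lambda>i. (f x i - f y i)\<^sup>2) has_sum ((d x y)\<^sup>2 / 2)) (?J x)"
      by (subst has_sum_reindex, simp add: inj_on_def)
         (rule has_sum_cong[THEN iffD1, rotated, OF half], use ne w0 in \<open>auto simp: f_def\<close>)
    have jy: "((\<lambda>i. (f x i - f y i)\<^sup>2) has_sum ((d x y)\<^sup>2 / 2)) (?J y)"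
      by (subst has_sum_reindex, simp add: inj_on_def)
         (rule has_sum_cong[THEN iffD1, rotated, OF half], use ne w0 in \<open>auto simp: f_def\<close>)
    have "((\<lambda>i. (f x i - f y i)\<^sup>2) has_sum ((d x y)\<^sup>2)) (?J x \<union> ?J y)"
      using has_sum_Un_disjoint[OF jx jy] ne by fastforce
    then show ?thesis
    proof (rule has_sum_cong_neutral[THEN iffD1, rotated -1])
      fix i assume i: "i \<in> I - (?J x \<union> ?J y)"
      obtain t B where tB: "i = (t, B)" by fastforce
      have "mball x t = mball y t" if "B = mball x t \<or> B = mball y t"
        using that i x y ball_eq[OF x y, of t] by (auto simp: tB I_def A_def)
      then show "(f x i - f y i)\<^sup>2 = 0" by (auto simp: tB f_def)
    next
      fix i assume "i \<in> ?J x \<union> ?J y - I"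
      then show "(f x i - f y i)\<^sup>2 = 0" using x y by (auto simp: I_def A_def)
    qed auto
  qed
  ultimately show ?thesis
    by (rule ell2_from_countable_coordinates) auto
qed auto

section \<open>Realising an ultrametric fractal in the Hilbert space\<close>

text \<open>
  The supremum \<open>Lip m f\<close> is itself a real Lipschitz constant when it is finite, so the definition by
  extended reals amounts to the usual inequality, also on a one-point space.
\<close>

lemma contracting_self_map_iff:
  "contracting_self_map m f \<longleftrightarrow> f \<in> mspace m \<rightarrow>\<^sub>E mspace m \<and>
     (\<exists>c. 0 \<le> c \<and> c < 1 \<and> (\<forall>x\<in>mspace m. \<forall>y\<in>mspace m. mdist m (f x) (f y) \<le> c * mdist m x y))"
proof -
  have "\<exists>c. 0 \<le> c \<and> c < 1 \<and> (\<forall>x\<in>mspace m. \<forall>y\<in>mspace m. mdist m (f x) (f y) \<le> c * mdist m x y)"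
    if f: "f \<in> mspace m \<rightarrow>\<^sub>E mspace m" and L: "Lip m f < 1"
  proof (intro exI[of _ "enn2real (Lip m f)"] conjI ballI)
    have "Lip m f < top" by (rule order_less_trans[OF L]) simp
    then have c: "ennreal (enn2real (Lip m f)) = Lip m f" by (rule ennreal_enn2real)
    then have "ennreal (enn2real (Lip m f)) < 1" using L by simp
    then show "enn2real (Lip m f) < 1" by (simp add: ennreal_less_one_iff)
    fix x y assume xy: "x \<in> mspace m" "y \<in> mspace m"
    show "mdist m (f x) (f y) \<le> enn2real (Lip m f) * mdist m x y"
    proof (cases "x = y")
      case True
      have "f y \<in> mspace m" using f xy(2) by (rule PiE_mem)
      then have "mdist m (f y) (f y) = 0" by (intro mdist_zero[THEN iffD2]) auto
      with True show ?thesis by simp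
    next
      case False
      then have pos: "mdist m x y > 0"
        using mdist_zero[OF xy] mdist_nonneg[of m x y] by linarith
      have "ennreal (mdist m (f x) (f y) / mdist m x y) \<le> ennreal (enn2real (Lip m f))"
        unfolding c unfolding Lip_def using xy False by (intro SUP_upper2[of "(x, y)"]) auto
      then have "mdist m (f x) (f y) / mdist m x y \<le> enn2real (Lip m f)"
        by (simp add: ennreal_le_iff)
      then show ?thesis using pos by (simp add: divide_le_eq)
    qed
  qed simp
  moreover have "Lip m f < 1"
    if c: "0 \<le> c" "c < 1" and "\<forall>x\<in>mspace m. \<forall>y\<in>mspace m. mdist m (f x) (f y) \<le> c * mdist m x y" for c
  proof -
    have "Lip m f \<le> ennreal c"
      unfolding Lip_def
    proof (rule SUP_least, clarify)
      fix x y assume xy: "x \<in> mspace m" "y \<in> mspace m" "x \<noteq> y"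
      then have "mdist m x y > 0"
        using mdist_zero[OF xy(1,2)] mdist_nonneg[of m x y] by linarith
      with that xy show "ennreal (mdist m (f x) (f y) / mdist m x y) \<le> ennreal c"
        by (intro ennreal_leI) (simp add: divide_le_eq)
    qed
    also have "\<dots> < 1" using c by (simp add: ennreal_less_one_iff)
    finally show ?thesis .
  qed
  ultimately show ?thesis unfolding contracting_self_map_def by blast
qed

theorem theorem3p4:
  fixes X :: "'a metric" and F :: "('a \<Rightarrow> 'a) set"
  assumes "ultrametric_fractal X F"
  shows "\<exists>(L :: ell2 set) G.
           fractal_in (euclidean_metric :: ell2 metric) L G \<and>
           isometrically_equivalent X F (submetric (euclidean_metric :: ell2 metric) L) G"
proof -
  let ?E = "euclidean_metric :: ell2 metric"
  define M where "M = mspace X"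
  interpret Metric_space M "mdist X" unfolding M_def by (rule Metric_space_mspace_mdist)
  have ne: "M \<noteq> {}" and cpt: "compact_space (mtopology_of X)" and "finite F"
    and F: "\<And>f. f \<in> F \<Longrightarrow> contracting_self_map X f" and cover: "M = (\<Union>f\<in>F. f ` M)"
    and um: "ultrametric X"
    using assms unfolding ultrametric_fractal_def metric_fractal_def M_def by auto
  have "compact_space mtopology" using cpt by (simp add: mtopology_of_def M_def)
  then have "mtotally_bounded M"
    by (simp add: compact_space_eq_mcomplete_mtotally_bounded)
  then obtain h :: "'a \<Rightarrow> ell2" where h: "\<And>x y. x \<in> M \<Longrightarrow> y \<in> M \<Longrightarrow> dist (h x) (h y) = mdist X x y"
    using ultrametric_isometric_embedding_ell2 um unfolding ultrametric_def M_def by blast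
  define L where "L = h ` M"
  define push where "push f = restrict (h \<circ> f \<circ> inv_into M h) L" for f
  have "inj_on h M" using h by (metis dist_self inj_onI zero)
  then have push: "push f (h x) = h (f x)" if "x \<in> M" for f x
    using that by (simp add: push_def L_def)
  have FM: "f x \<in> M" if "f \<in> F" "x \<in> M" for f x
    using F[OF that(1)] that(2) unfolding contracting_self_map_def M_def by blast
  have Lipf: "\<exists>c. 0 \<le> c \<and> c < 1 \<and> c-lipschitz_on L (push f)" if f: "f \<in> F" for f
  proof -
    obtain c where c: "0 \<le> c" "c < 1"
      "\<And>x y. x \<in> M \<Longrightarrow> y \<in> M \<Longrightarrow> mdist X (f x) (f y) \<le> c * mdist X x y"
      using F[OF f] unfolding contracting_self_map_iff M_def by blast
    then have "c-lipschitz_on L (push f)"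
      by (auto simp: lipschitz_on_def L_def push h FM f)
    with c show ?thesis by blast
  qed
  have "continuous_map (mtopology_of X) (mtopology_of ?E) h"
    by (intro Lipschitz_continuous_imp_continuous_map)
       (auto simp: Lipschitz_continuous_map_def h simp flip: M_def intro!: exI[of _ 1])
  with cpt have "compactin euclidean (h ` topspace (mtopology_of X))"
    by (metis compact_space_def image_compactin mtopology_of_euclidean)
  then have L: "compact L" by (simp add: L_def M_def)
  have LL: "push f ` L \<subseteq> L" if "f \<in> F" for f
    using that FM by (auto simp: L_def push)
  define K where "K = closure (convex hull L)"
  have K: "compact K" "convex K" "K \<noteq> {}" "L \<subseteq> K"
    using compact_closure_convex_hull[OF L] ne hull_subset[of L convex] closure_subset[of "convex hull L"]
    by (auto simp: K_def L_def convex_closure convex_convex_hull)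
  have "metric_fractal (submetric ?E L) (push ` F)"
    unfolding metric_fractal_def
  proof (intro conjI ballI)
    show "compact_space (mtopology_of (submetric ?E L))"
      using L by (simp add: mtopology_of_submetric compact_space_subtopology)
    show "contracting_self_map (submetric ?E L) g" if g: "g \<in> push ` F" for g
    proof -
      obtain f where f: "f \<in> F" "g = push f" using g by blast
      have "g \<in> L \<rightarrow>\<^sub>E L" using LL[OF f(1)] f(2) by (auto simp: push_def)
      with Lipf[OF f(1)] show ?thesis
        unfolding contracting_self_map_iff f(2) by (auto simp: lipschitz_on_def)
    qed
    have "L = (\<Union>f\<in>F. h ` f ` M)" unfolding L_def by (subst cover) (rule image_UN)
    also have "\<dots> = (\<Union>f\<in>F. push f ` L)"
      by (intro SUP_cong refl) (auto simp: L_def image_image push)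
    finally show "mspace (submetric ?E L) = (\<Union>g\<in>push ` F. g ` mspace (submetric ?E L))" by simp
  qed (use ne \<open>finite F\<close> in \<open>auto simp: L_def\<close>)
  moreover have "\<exists>e. contracting_self_map ?E e \<and> g = restrict e L" if g: "g \<in> push ` F" for g
  proof -
    obtain f where f: "f \<in> F" "g = push f" using g by blast
    obtain c where c: "0 \<le> c" "c < 1" "c-lipschitz_on L g" using Lipf f by blast
    obtain e where e: "c-lipschitz_on UNIV e" "\<forall>x\<in>L. e x = g x"
      using lipschitz_extension_into_compact_convex[OF c(3) _ K(1-3)] LL[OF f(1)] K(4) f(2) by blast
    have "contracting_self_map ?E e"
      using e(1) c by (auto simp: contracting_self_map_iff lipschitz_on_def)
    moreover have "g = restrict e L" using e(2) f(2) by (auto simp: push_def restrict_def)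
    ultimately show ?thesis by blast
  qed
  moreover have "mcomplete_of ?E"
    by (simp add: mcomplete_of_def complete_UNIV)
  ultimately have "fractal_in ?E L (push ` F)" by (simp add: fractal_in_def)
  moreover have "isometrically_equivalent X F (submetric ?E L) (push ` F)"
    unfolding isometrically_equivalent_def
    by (rule exI[of _ h]) (auto simp: L_def push_def h image_def simp flip: M_def)
  ultimately show ?thesis by blast
qed

end
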